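(* Let $Q$ be one of $\mathrm{A}_{2n-1}$, $\mathrm{D}_{n+1}$, $\mathrm{E}_6$, $\mathrm{D}_4$, and let $\sigma$ be the automorphism of the Brauer algebra $\mathrm{Br}(Q)$ extending the corresponding classical diagram automorphism described in the context (so $\sigma(R_i)=R_{\sigma(i)}$ and $\sigma(E_i)=E_{\sigma(i)}$). Then $\sigma$ is height invariant: $\mathrm{ht}(\sigma(a))=\mathrm{ht}(a)$ for every monomial $a\in\mathrm{BrM}(Q)$.
   Context: For a graph $Q$, write $i\sim j$ if nodes $i,j$ are adjacent. The Brauer monoid $\mathrm{BrM}(Q)$ is the monoid generated by $R_i,E_i$ ($i$ a node of $Q$) and $\delta,\delta^{-1}$ ($\delta$ central) with relations: $\delta\delta^{-1}=1$; $R_i^2=1$; $R_iE_i=E_iR_i=E_i$; $E_i^2=\delta E_i$; for distinct $i\not\sim j$: $R_iR_j=R_jR_i$, $E_iR_j=R_jE_i$, $E_iE_j=E_jE_i$; for $i\sim j$: $R_iR_jR_i=R_jR_iR_j$, $R_jR_iE_j=E_iE_j$, $R_iE_jR_i=R_jE_iR_j$. The Brauer algebra $\mathrm{Br}(Q)$ is the monoid algebra $\mathbb{Z}[\mathrm{BrM}(Q)]$; elements of $\mathrm{BrM}(Q)$ are called monomials. The height $\mathrm{ht}(a)$ of $a\in\mathrm{BrM}(Q)$ is the minimal number of occurrences of generators $R_i$ in an expression of $a$ as a word in the generators $R_i,E_i,\delta^{\pm1}$. Diagrams: $\mathrm{A}_{m}$ is the path $1-2-\cdots-m$; $\mathrm{D}_m$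 has nodes $1,\dots,m$ and edges $1-3$, $2-3$, $i-(i+1)$ for $3\le i\le m-1$; $\mathrm{E}_6$ has nodes $1,\dots,6$ and edges $1-3$, $3-4$, $2-4$, $4-5$, $5-6$. Diagram automorphisms $\sigma$: on $\mathrm{A}_{2n-1}$, $i\mapsto 2n-i$ (used for type $\mathrm{C}_n$); on $\mathrm{D}_{n+1}$, swapping nodes $1$ and $2$ and fixing the others (type $\mathrm{B}_n$); on $\mathrm{E}_6$, $1\leftrightarrow 6$, $3\leftrightarrow5$, fixing $2$ and $4$ (type $\mathrm{F}_4$); on $\mathrm{D}_4$, an automorphism of order three permuting $1,2,4$ cyclically and fixing $3$ (type $\mathrm{G}_2$). In each case $\sigma$ fixes $\delta$. *)

theory Defs
  imports "HOL-Algebra.Algebra" "HOL-Library.Poly_Mapping"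
begin

section \<open>Graphs and the classical diagrams\<close>

record 'v graph =
  nodes :: "'v set"
  edges :: "'v set set"

definition adjacent :: "'v graph \<Rightarrow> 'v \<Rightarrow> 'v \<Rightarrow> bool" where
  "adjacent Q i j \<longleftrightarrow> {i, j} \<in> edges Q"

definition diagram_A :: "nat \<Rightarrow> nat graph" where
  "diagram_A m = \<lparr>nodes = {1..m}, edges = {{i, i + 1} | i. 1 \<le> i \<and> i + 1 \<le> m}\<rparr>"

text \<open>This is the intended diagram only for \<open>m \<ge> 3\<close>, since the branch node is \<open>3\<close>.\<close>

definition diagram_D :: "nat \<Rightarrow> nat graph" where
  "diagram_D m = \<lparr>nodes = {1..m},
     edges = {{1, 3}, {2, 3}} \<union> {{i, i + 1} | i. 3 \<le> i \<and> i + 1 \<le> m}\<rparr>"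

definition diagram_E6 :: "nat graph" where
  "diagram_E6 = \<lparr>nodes = {1..6}, edges = {{1, 3}, {3, 4}, {2, 4}, {4, 5}, {5, 6}}\<rparr>"

text \<open>
  The four families correspond to the types \<open>C\<^sub>n\<close>, \<open>B\<^sub>n\<close>, \<open>F\<^sub>4\<close>, \<open>G\<^sub>2\<close>. The map \<open>s\<close> is only
  constrained on the nodes. For \<open>G\<^sub>2\<close> both cyclic permutations of \<open>1, 2, 4\<close> are admitted.
\<close>

definition classical_diagram_aut :: "nat graph \<Rightarrow> (nat \<Rightarrow> nat) \<Rightarrow> bool" where
  "classical_diagram_aut Q s \<longleftrightarrow>
     (\<exists>n\<ge>1. Q = diagram_A (2 * n - 1) \<and> (\<forall>i\<in>nodes Q. s i = 2 * n - i)) \<or>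
     (\<exists>n\<ge>2. Q = diagram_D (n + 1) \<and> s 1 = 2 \<and> s 2 = 1 \<and> (\<forall>i\<in>nodes Q - {1, 2}. s i = i)) \<or>
     (Q = diagram_E6 \<and> s 1 = 6 \<and> s 6 = 1 \<and> s 3 = 5 \<and> s 5 = 3 \<and> s 2 = 2 \<and> s 4 = 4) \<or>
     (Q = diagram_D 4 \<and> s 3 = 3 \<and>
        (s 1 = 2 \<and> s 2 = 4 \<and> s 4 = 1 \<or> s 1 = 4 \<and> s 4 = 2 \<and> s 2 = 1))"


section \<open>The Brauer monoid\<close>

datatype 'v brauer_gen = GenR 'v | GenE 'v | Delta | DeltaInv

definition brauer_gens :: "'v graph \<Rightarrow> 'v brauer_gen set" where
  "brauer_gens Q = GenR ` nodes Q \<union> GenE ` nodes Q \<union> {Delta, DeltaInv}"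

text \<open>
  A word stands for the product of its letters from left to right. Centrality of \<open>Delta\<close>
  is imposed with respect to every generator, including \<open>DeltaInv\<close>; hence \<open>DeltaInv\<close> is a
  two-sided inverse of \<open>Delta\<close> and central as well.
\<close>

inductive brauer_rel :: "'v graph \<Rightarrow> 'v brauer_gen list \<Rightarrow> 'v brauer_gen list \<Rightarrow> bool"
  for Q :: "'v graph" where
  delta_inv: "brauer_rel Q [Delta, DeltaInv] []"
| delta_central: "g \<in> brauer_gens Q \<Longrightarrow> brauer_rel Q [Delta, g] [g, Delta]"
| RR: "i \<in> nodes Q \<Longrightarrow> brauer_rel Q [GenR i, GenR i] []"
| RE: "i \<in> nodes Q \<Longrightarrow> brauer_rel Q [GenR i, GenE i] [GenE i]"
| ER: "i \<in> nodes Q \<Longrightarrow> brauer_rel Q [GenE i, GenR i] [GenE i]"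
| EE: "i \<in> nodes Q \<Longrightarrow> brauer_rel Q [GenE i, GenE i] [Delta, GenE i]"
| RR_comm: "\<lbrakk>i \<in> nodes Q; j \<in> nodes Q; i \<noteq> j; \<not> adjacent Q i j\<rbrakk>
    \<Longrightarrow> brauer_rel Q [GenR i, GenR j] [GenR j, GenR i]"
| ER_comm: "\<lbrakk>i \<in> nodes Q; j \<in> nodes Q; i \<noteq> j; \<not> adjacent Q i j\<rbrakk>
    \<Longrightarrow> brauer_rel Q [GenE i, GenR j] [GenR j, GenE i]"
| EE_comm: "\<lbrakk>i \<in> nodes Q; j \<in> nodes Q; i \<noteq> j; \<not> adjacent Q i j\<rbrakk>
    \<Longrightarrow> brauer_rel Q [GenE i, GenE j] [GenE j, GenE i]"
| RRR: "\<lbrakk>i \<in> nodes Q; j \<in> nodes Q; adjacent Q i j\<rbrakk>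
    \<Longrightarrow> brauer_rel Q [GenR i, GenR j, GenR i] [GenR j, GenR i, GenR j]"
| RRE: "\<lbrakk>i \<in> nodes Q; j \<in> nodes Q; adjacent Q i j\<rbrakk>
    \<Longrightarrow> brauer_rel Q [GenR j, GenR i, GenE j] [GenE i, GenE j]"
| RER: "\<lbrakk>i \<in> nodes Q; j \<in> nodes Q; adjacent Q i j\<rbrakk>
    \<Longrightarrow> brauer_rel Q [GenR i, GenE j, GenR i] [GenR j, GenE i, GenR j]"

inductive_set brauer_cong :: "'v graph \<Rightarrow> ('v brauer_gen list \<times> 'v brauer_gen list) set"
  for Q :: "'v graph" where
  cong_rel: "\<lbrakk>brauer_rel Q u v; x \<in> lists (brauer_gens Q); y \<in> lists (brauer_gens Q)\<rbrakk>
    \<Longrightarrow> (x @ u @ y, x @ v @ y) \<in> brauer_cong Q"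
| cong_refl: "w \<in> lists (brauer_gens Q) \<Longrightarrow> (w, w) \<in> brauer_cong Q"
| cong_sym: "(u, v) \<in> brauer_cong Q \<Longrightarrow> (v, u) \<in> brauer_cong Q"
| cong_trans: "\<lbrakk>(u, v) \<in> brauer_cong Q; (v, w) \<in> brauer_cong Q\<rbrakk> \<Longrightarrow> (u, w) \<in> brauer_cong Q"

definition brauer_class :: "'v graph \<Rightarrow> 'v brauer_gen list \<Rightarrow> 'v brauer_gen list set" where
  "brauer_class Q w = brauer_cong Q `` {w}"

definition BrM :: "'v graph \<Rightarrow> 'v brauer_gen list set monoid" where
  "BrM Q = \<lparr>carrier = lists (brauer_gens Q) // brauer_cong Q,
            monoid.mult = (\<lambda>a b. \<Union>u\<in>a. \<Union>v\<in>b. brauer_class Q (u @ v)),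
            one = brauer_class Q []\<rparr>"

fun is_R :: "'v brauer_gen \<Rightarrow> bool" where
  "is_R (GenR i) = True"
| "is_R _ = False"

definition ht :: "'v graph \<Rightarrow> 'v brauer_gen list set \<Rightarrow> nat" where
  "ht Q a = (LEAST k. \<exists>w\<in>lists (brauer_gens Q).
                brauer_class Q w = a \<and> k = length (filter is_R w))"


section \<open>The Brauer algebra\<close>

text \<open>
  The integral monoid algebra on the free abelian group with basis \<open>carrier M\<close>; a monoid
  element \<open>a\<close> is identified with the basis vector \<^term>\<open>frag_of a\<close>, and multiplication is the
  bilinear extension of that of \<open>M\<close>.
\<close>

definition monoid_algebra :: "('a, 'm) monoid_scheme \<Rightarrow> ('a \<Rightarrow>\<^sub>0 int) ring" where
  "monoid_algebra M =
     \<lparr>carrier = {f. Poly_Mapping.keys f \<subseteq> carrier M},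
      monoid.mult = (\<lambda>f g. frag_extend (\<lambda>a. frag_extend (\<lambda>b. frag_of (a \<otimes>\<^bsub>M\<^esub> b)) g) f),
      one = frag_of \<one>\<^bsub>M\<^esub>,
      ring.zero = 0,
      ring.add = (+)\<rparr>"

definition Br :: "'v graph \<Rightarrow> ('v brauer_gen list set \<Rightarrow>\<^sub>0 int) ring" where
  "Br Q = monoid_algebra (BrM Q)"

definition br_gen :: "'v graph \<Rightarrow> 'v brauer_gen \<Rightarrow> 'v brauer_gen list set \<Rightarrow>\<^sub>0 int" where
  "br_gen Q g = frag_of (brauer_class Q [g])"

text \<open>
  A unital ring automorphism of \<open>Br Q\<close> is automatically linear over the integers and
  fixes the inverse of \<open>Delta\<close> once it fixes \<open>Delta\<close>.
\<close>

definition extends_diagram_aut ::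
  "'v graph \<Rightarrow> ('v \<Rightarrow> 'v) \<Rightarrow> (('v brauer_gen list set \<Rightarrow>\<^sub>0 int) \<Rightarrow> ('v brauer_gen list set \<Rightarrow>\<^sub>0 int)) \<Rightarrow> bool"
where
  "extends_diagram_aut Q s \<sigma> \<longleftrightarrow>
     \<sigma> \<in> ring_iso (Br Q) (Br Q) \<and>
     (\<forall>i\<in>nodes Q. \<sigma> (br_gen Q (GenR i)) = br_gen Q (GenR (s i))) \<and>
     (\<forall>i\<in>nodes Q. \<sigma> (br_gen Q (GenE i)) = br_gen Q (GenE (s i))) \<and>
     \<sigma> (br_gen Q Delta) = br_gen Q Delta"


section \<open>Well-definedness\<close>

lemma brauer_rel_lists:
  assumes "brauer_rel Q u v"
  shows "u \<in> lists (brauer_gens Q) \<and> v \<in> lists (brauer_gens Q)"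
  using assms by (induction) (auto simp: brauer_gens_def)

lemma brauer_cong_lists:
  assumes "(u, v) \<in> brauer_cong Q"
  shows "u \<in> lists (brauer_gens Q) \<and> v \<in> lists (brauer_gens Q)"
  using assms
proof induction
  case (cong_rel u v x y)
  then show ?case using brauer_rel_lists[of Q u v] by auto
qed auto

lemma equiv_brauer_cong: "equiv (lists (brauer_gens Q)) (brauer_cong Q)"
proof (rule equivI)
  show "brauer_cong Q \<subseteq> lists (brauer_gens Q) \<times> lists (brauer_gens Q)"
    by (auto dest: brauer_cong_lists simp del: in_lists_conv_set)
  show "refl_on (lists (brauer_gens Q)) (brauer_cong Q)"
    by (rule refl_onI) (rule brauer_cong.cong_refl)
  show "sym_on UNIV (brauer_cong Q)"
    by (rule symI) (rule brauer_cong.cong_sym)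
  show "trans_on UNIV (brauer_cong Q)"
    by (rule transI) (rule brauer_cong.cong_trans)
qed

lemma brauer_class_eq_iff:
  assumes "u \<in> lists (brauer_gens Q)" "v \<in> lists (brauer_gens Q)"
  shows "brauer_class Q u = brauer_class Q v \<longleftrightarrow> (u, v) \<in> brauer_cong Q"
  unfolding brauer_class_def by (rule eq_equiv_class_iff[OF equiv_brauer_cong assms])

lemma brauer_cong_append_right:
  assumes "(u, v) \<in> brauer_cong Q" "z \<in> lists (brauer_gens Q)"
  shows "(u @ z, v @ z) \<in> brauer_cong Q"
  using assms
proof induction
  case (cong_rel u v x y)
  then have "y @ z \<in> lists (brauer_gens Q)" by auto
  from brauer_cong.cong_rel[OF cong_rel(1) cong_rel(2) this] show ?case by simp
next
  case (cong_refl w)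
  then show ?case by (intro brauer_cong.cong_refl) auto
next
  case (cong_sym u v)
  then show ?case by (simp only: brauer_cong.cong_sym)
next
  case (cong_trans u v w)
  then show ?case using brauer_cong.cong_trans by metis
qed

lemma brauer_cong_append_left:
  assumes "(u, v) \<in> brauer_cong Q" "z \<in> lists (brauer_gens Q)"
  shows "(z @ u, z @ v) \<in> brauer_cong Q"
  using assms
proof induction
  case (cong_rel u v x y)
  then have "z @ x \<in> lists (brauer_gens Q)" by auto
  from brauer_cong.cong_rel[OF cong_rel(1) this cong_rel(3)] show ?case by simp
next
  case (cong_refl w)
  then show ?case by (intro brauer_cong.cong_refl) auto
next
  case (cong_sym u v)
  then show ?case by (simp only: brauer_cong.cong_sym)
next
  case (cong_trans u v w)
  then show ?case using brauer_cong.cong_trans by metis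
qed

lemma brauer_cong_append:
  assumes "(u, u') \<in> brauer_cong Q" "(v, v') \<in> brauer_cong Q"
  shows "(u @ v, u' @ v') \<in> brauer_cong Q"
  using brauer_cong.cong_trans[OF brauer_cong_append_right[OF assms(1)] brauer_cong_append_left[OF assms(2)]]
    brauer_cong_lists[OF assms(1)] brauer_cong_lists[OF assms(2)] by blast

lemma carrier_BrM: "carrier (BrM Q) = brauer_class Q ` lists (brauer_gens Q)"
  by (auto simp: BrM_def quotient_def brauer_class_def)

lemma in_brauer_class: "w \<in> lists (brauer_gens Q) \<Longrightarrow> w \<in> brauer_class Q w"
  unfolding brauer_class_def by (rule ImageI[OF brauer_cong.cong_refl]) simp_all

lemma brauer_class_eqI:
  assumes "(u, v) \<in> brauer_cong Q"
  shows "brauer_class Q u = brauer_class Q v"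
  unfolding brauer_class_def by (rule equiv_class_eq[OF equiv_brauer_cong assms])

lemma mult_BrM:
  assumes "u \<in> lists (brauer_gens Q)" "v \<in> lists (brauer_gens Q)"
  shows "brauer_class Q u \<otimes>\<^bsub>BrM Q\<^esub> brauer_class Q v = brauer_class Q (u @ v)"
proof -
  have *: "brauer_class Q (u' @ v') = brauer_class Q (u @ v)"
    if "u' \<in> brauer_class Q u" "v' \<in> brauer_class Q v" for u' v'
    by (rule sym[OF brauer_class_eqI[OF brauer_cong_append]])
      (use that in \<open>simp_all add: brauer_class_def\<close>)
  have "(\<Union>u'\<in>brauer_class Q u. \<Union>v'\<in>brauer_class Q v. brauer_class Q (u' @ v'))
      = brauer_class Q (u @ v)"
    using in_brauer_class[OF assms(1)] in_brauer_class[OF assms(2)]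
    by (intro SUP_eq_const *) auto
  then show ?thesis
    by (simp add: BrM_def)
qed

lemma one_BrM: "\<one>\<^bsub>BrM Q\<^esub> = brauer_class Q []"
  by (simp add: BrM_def)

lemma monoid_BrM: "monoid (BrM Q)"
proof (rule monoidI)
  have app: "u @ v \<in> lists (brauer_gens Q)"
    if "u \<in> lists (brauer_gens Q)" "v \<in> lists (brauer_gens Q)" for u v
    using that by simp
  have nil: "[] \<in> lists (brauer_gens Q)" by simp
  show "\<one>\<^bsub>BrM Q\<^esub> \<in> carrier (BrM Q)"
    unfolding carrier_BrM one_BrM by (rule imageI[OF nil])
  fix a assume "a \<in> carrier (BrM Q)"
  then obtain u where u: "u \<in> lists (brauer_gens Q)" "a = brauer_class Q u"
    unfolding carrier_BrM by (rule imageE)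
  show "\<one>\<^bsub>BrM Q\<^esub> \<otimes>\<^bsub>BrM Q\<^esub> a = a" "a \<otimes>\<^bsub>BrM Q\<^esub> \<one>\<^bsub>BrM Q\<^esub> = a"
    unfolding u(2) one_BrM mult_BrM[OF nil u(1)] mult_BrM[OF u(1) nil] by simp_all
  fix b assume "b \<in> carrier (BrM Q)"
  then obtain v where v: "v \<in> lists (brauer_gens Q)" "b = brauer_class Q v"
    unfolding carrier_BrM by (rule imageE)
  show "a \<otimes>\<^bsub>BrM Q\<^esub> b \<in> carrier (BrM Q)"
    unfolding u(2) v(2) mult_BrM[OF u(1) v(1)] carrier_BrM by (rule imageI[OF app[OF u(1) v(1)]])
  fix c assume "c \<in> carrier (BrM Q)"
  then obtain w where w: "w \<in> lists (brauer_gens Q)" "c = brauer_class Q w"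
    unfolding carrier_BrM by (rule imageE)
  show "a \<otimes>\<^bsub>BrM Q\<^esub> b \<otimes>\<^bsub>BrM Q\<^esub> c = a \<otimes>\<^bsub>BrM Q\<^esub> (b \<otimes>\<^bsub>BrM Q\<^esub> c)"
    unfolding u(2) v(2) w(2) mult_BrM[OF u(1) v(1)] mult_BrM[OF v(1) w(1)]
      mult_BrM[OF app[OF u(1) v(1)] w(1)] mult_BrM[OF u(1) app[OF v(1) w(1)]] by simp
qed

lemma frag_extend_in_carrier:
  assumes "Poly_Mapping.keys f \<subseteq> S"
    and "\<And>a. a \<in> S \<Longrightarrow> Poly_Mapping.keys (h a) \<subseteq> T"
  shows "Poly_Mapping.keys (frag_extend h f) \<subseteq> T"
proof -
  have "(\<Union>x\<in>Poly_Mapping.keys f. Poly_Mapping.keys (h x)) \<subseteq> T"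
    using assms by (intro UN_least) auto
  with keys_frag_extend show ?thesis by (rule order_trans)
qed

lemma frag_extend_fun_diff:
  "frag_extend (\<lambda>a. h a - k a) f = frag_extend h f - frag_extend k f"
  by (induction f rule: frag_induction[OF subset_UNIV]) (simp_all add: frag_extend_diff)

lemma frag_extend_fun_add:
  "frag_extend (\<lambda>a. h a + k a) f = frag_extend h f + frag_extend k f"
  by (induction f rule: frag_induction[OF subset_UNIV]) (simp_all add: frag_extend_diff)

lemma ring_monoid_algebra:
  assumes "monoid M"
  shows "ring (monoid_algebra M)"
proof -
  interpret monoid M by fact
  let ?m = "\<lambda>f g. frag_extend (\<lambda>a. frag_extend (\<lambda>b. frag_of (a \<otimes>\<^bsub>M\<^esub> b)) g) f"
  have ml: "?m (f - f') g = ?m f g - ?m f' g" for f f' g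
    by (simp add: frag_extend_diff)
  have mr: "?m f (g - g') = ?m f g - ?m f g'" for f g g'
    by (simp add: frag_extend_diff frag_extend_fun_diff)
  have z: "?m f 0 = 0" for f
    by (simp add: frag_extend_eq_0)
  have closed: "Poly_Mapping.keys (?m f g) \<subseteq> carrier M"
    if "Poly_Mapping.keys f \<subseteq> carrier M" "Poly_Mapping.keys g \<subseteq> carrier M" for f g
    by (rule frag_extend_in_carrier[OF that(1)], rule frag_extend_in_carrier[OF that(2)]) auto
  have assoc: "?m (?m f g) h = ?m f (?m g h)"
    if "Poly_Mapping.keys f \<subseteq> carrier M" "Poly_Mapping.keys g \<subseteq> carrier M"
      "Poly_Mapping.keys h \<subseteq> carrier M" for f g h
    using that(1)
  proof (induction f rule: frag_induction)
    case (one a)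
    show ?case using that(2)
    proof (induction g rule: frag_induction)
      case (one b)
      show ?case using that(3)
        by (induction h rule: frag_induction)
          (use \<open>a \<in> carrier M\<close> \<open>b \<in> carrier M\<close> in \<open>auto simp: frag_extend_diff m_assoc\<close>)
    qed (auto simp: frag_extend_diff)
  qed (auto simp: frag_extend_diff)
  have onel: "?m (frag_of \<one>\<^bsub>M\<^esub>) f = f" and oner: "?m f (frag_of \<one>\<^bsub>M\<^esub>) = f"
    if "Poly_Mapping.keys f \<subseteq> carrier M" for f
    using that by (induction f rule: frag_induction; simp add: frag_extend_diff)+
  have "abelian_group (monoid_algebra M)"
  proof (rule abelian_groupI)
    fix x assume "x \<in> carrier (monoid_algebra M)"
    then show "\<exists>y\<in>carrier (monoid_algebra M). y \<oplus>\<^bsub>monoid_algebra M\<^esub> x = \<zero>\<^bsub>monoid_algebra M\<^esub>"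
      by (intro bexI[of _ "- x"]) (auto simp: monoid_algebra_def)
  next
    fix x y assume "x \<in> carrier (monoid_algebra M)" "y \<in> carrier (monoid_algebra M)"
    then show "x \<oplus>\<^bsub>monoid_algebra M\<^esub> y \<in> carrier (monoid_algebra M)"
      using Poly_Mapping.keys_add[of x y] by (auto simp: monoid_algebra_def)
  qed (auto simp: monoid_algebra_def algebra_simps)
  moreover have "monoid (monoid_algebra M)"
    by (rule monoidI) (use closed assoc onel oner in \<open>auto simp: monoid_algebra_def\<close>)
  ultimately show ?thesis
    by (rule ringI) (auto simp: monoid_algebra_def frag_extend_add frag_extend_fun_add)
qed

lemma ring_Br: "ring (Br Q)"
  unfolding Br_def by (rule ring_monoid_algebra[OF monoid_BrM])

definition diagram_aut :: "'v graph \<Rightarrow> ('v \<Rightarrow> 'v) \<Rightarrow> bool" where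
  "diagram_aut Q s \<longleftrightarrow> bij_betw s (nodes Q) (nodes Q) \<and>
     (\<forall>i\<in>nodes Q. \<forall>j\<in>nodes Q. adjacent Q (s i) (s j) \<longleftrightarrow> adjacent Q i j)"

lemma diagram_aut_inv:
  assumes "diagram_aut Q s"
  shows "diagram_aut Q (inv_into (nodes Q) s)"
proof -
  let ?t = "inv_into (nodes Q) s"
  have s: "bij_betw s (nodes Q) (nodes Q)"
    and adj: "\<And>i j. i \<in> nodes Q \<Longrightarrow> j \<in> nodes Q \<Longrightarrow> adjacent Q (s i) (s j) \<longleftrightarrow> adjacent Q i j"
    using assms by (simp_all add: diagram_aut_def)
  have t: "bij_betw ?t (nodes Q) (nodes Q)"
    by (rule bij_betw_inv_into[OF s])
  have "adjacent Q (?t i) (?t j) \<longleftrightarrow> adjacent Q i j" if "i \<in> nodes Q" "j \<in> nodes Q" for i j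
    using adj[of "?t i" "?t j"] that bij_betw_apply[OF t] bij_betw_inv_into_right[OF s] by simp
  with t show ?thesis
    by (simp add: diagram_aut_def)
qed

lemma map_gen:
  assumes "diagram_aut Q s" "g \<in> brauer_gens Q"
  shows "map_brauer_gen s g \<in> brauer_gens Q"
proof -
  have "s i \<in> nodes Q" if "i \<in> nodes Q" for i
    using assms(1) that unfolding diagram_aut_def by (blast intro: bij_betw_apply)
  with assms(2) show ?thesis
    by (auto simp: brauer_gens_def)
qed

lemma map_word_lists:
  assumes "diagram_aut Q s" "w \<in> lists (brauer_gens Q)"
  shows "map (map_brauer_gen s) w \<in> lists (brauer_gens Q)"
  using assms(2) map_gen[OF assms(1)] by (induction w) simp_all

lemma map_word_rel:
  assumes "diagram_aut Q s" "brauer_rel Q u v"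
  shows "brauer_rel Q (map (map_brauer_gen s) u) (map (map_brauer_gen s) v)"
proof -
  have n: "s i \<in> nodes Q" if "i \<in> nodes Q" for i
    using assms(1) that by (auto simp: diagram_aut_def bij_betw_apply)
  have e: "s i = s j \<longleftrightarrow> i = j" if "i \<in> nodes Q" "j \<in> nodes Q" for i j
    using assms(1) that by (auto simp: diagram_aut_def bij_betw_def inj_on_eq_iff)
  have a: "adjacent Q (s i) (s j) \<longleftrightarrow> adjacent Q i j" if "i \<in> nodes Q" "j \<in> nodes Q" for i j
    using assms(1) that by (auto simp: diagram_aut_def)
  have g: "map_brauer_gen s g \<in> brauer_gens Q" if "g \<in> brauer_gens Q" for g
    using map_gen[OF assms(1) that] .
  show ?thesis
    using assms(2) by cases (auto intro!: brauer_rel.intros simp: n e a g)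
qed

lemma map_word_cong:
  assumes "diagram_aut Q s" "(u, v) \<in> brauer_cong Q"
  shows "(map (map_brauer_gen s) u, map (map_brauer_gen s) v) \<in> brauer_cong Q"
  using assms(2)
proof induction
  case (cong_rel u v x y)
  then show ?case
    using brauer_cong.cong_rel[OF map_word_rel[OF assms(1) cong_rel(1)]
        map_word_lists[OF assms(1) cong_rel(2)] map_word_lists[OF assms(1) cong_rel(3)]] by simp
next
  case (cong_refl w)
  then show ?case using map_word_lists[OF assms(1)] by (intro brauer_cong.cong_refl)
next
  case (cong_sym u v)
  then show ?case by (simp only: brauer_cong.cong_sym)
next
  case (cong_trans u v w)
  then show ?case using brauer_cong.cong_trans by metis
qed

definition class_map :: "'v graph \<Rightarrow> ('v \<Rightarrow> 'v) \<Rightarrow> 'v brauer_gen list set \<Rightarrow> 'v brauer_gen list set" where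
  "class_map Q s a = (\<Union>w\<in>a. brauer_class Q (map (map_brauer_gen s) w))"

lemma class_map_class:
  assumes "diagram_aut Q s" "w \<in> lists (brauer_gens Q)"
  shows "class_map Q s (brauer_class Q w) = brauer_class Q (map (map_brauer_gen s) w)"
proof -
  have *: "brauer_class Q (map (map_brauer_gen s) w') = brauer_class Q (map (map_brauer_gen s) w)"
    if "w' \<in> brauer_class Q w" for w'
    by (rule sym[OF brauer_class_eqI[OF map_word_cong[OF assms(1)]]])
      (use that in \<open>simp add: brauer_class_def\<close>)
  show ?thesis
    unfolding class_map_def using in_brauer_class[OF assms(2)] by (intro SUP_eq_const *) auto
qed

lemma class_map_inv:
  assumes "diagram_aut Q s" "diagram_aut Q t" "\<And>i. i \<in> nodes Q \<Longrightarrow> t (s i) = i"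
    and "a \<in> carrier (BrM Q)"
  shows "class_map Q t (class_map Q s a) = a"
proof -
  from assms(4) obtain w where w: "w \<in> lists (brauer_gens Q)" "a = brauer_class Q w"
    unfolding carrier_BrM by blast
  have "map_brauer_gen t (map_brauer_gen s g) = g" if "g \<in> brauer_gens Q" for g
    using that assms(3) by (auto simp: brauer_gens_def)
  then have *: "map (map_brauer_gen t) (map (map_brauer_gen s) w) = w"
    using w(1) by (induction w) simp_all
  show ?thesis
    unfolding w(2) class_map_class[OF assms(1) w(1)]
      class_map_class[OF assms(2) map_word_lists[OF assms(1) w(1)]] * ..
qed

text \<open>Every diagram automorphism extends to the Brauer algebra, so the hypothesis
  \<^const>\<open>extends_diagram_aut\<close> can always be met.\<close>

lemma ex_extends_diagram_aut:
  assumes s: "diagram_aut Q s"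
  shows "\<exists>\<sigma>. extends_diagram_aut Q s \<sigma>"
proof -
  define t where "t = inv_into (nodes Q) s"
  have t: "diagram_aut Q t" unfolding t_def by (rule diagram_aut_inv[OF s])
  have ts: "t (s i) = i" and st: "s (t i) = i" if "i \<in> nodes Q" for i
    using s that unfolding t_def diagram_aut_def
    by (auto simp: bij_betw_inv_into_left bij_betw_inv_into_right)
  define F where "F r = frag_extend (frag_of \<circ> class_map Q r)" for r
  have cl: "class_map Q r a \<in> carrier (BrM Q)" if "diagram_aut Q r" "a \<in> carrier (BrM Q)" for r a
  proof -
    from that(2) obtain w where w: "w \<in> lists (brauer_gens Q)" "a = brauer_class Q w"
      unfolding carrier_BrM by blast
    show ?thesis
      unfolding w(2) class_map_class[OF that(1) w(1)] carrier_BrM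
      by (rule imageI[OF map_word_lists[OF that(1) w(1)]])
  qed
  have hom: "class_map Q s (a \<otimes>\<^bsub>BrM Q\<^esub> b) = class_map Q s a \<otimes>\<^bsub>BrM Q\<^esub> class_map Q s b"
    if ab: "a \<in> carrier (BrM Q)" "b \<in> carrier (BrM Q)" for a b
  proof -
    from ab obtain u v where uv: "u \<in> lists (brauer_gens Q)" "v \<in> lists (brauer_gens Q)"
      "a = brauer_class Q u" "b = brauer_class Q v"
      by (auto simp: carrier_BrM simp del: in_lists_conv_set)
    have "u @ v \<in> lists (brauer_gens Q)" using uv by simp
    then show ?thesis
      using uv map_word_lists[OF s]
      by (simp add: mult_BrM class_map_class[OF s] del: in_lists_conv_set append_in_lists_conv)
  qed
  have Fcl: "Poly_Mapping.keys (F r f) \<subseteq> carrier (BrM Q)"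
    if "diagram_aut Q r" "Poly_Mapping.keys f \<subseteq> carrier (BrM Q)" for r f
    unfolding F_def by (rule frag_extend_in_carrier[OF that(2)]) (auto simp: cl[OF that(1)])
  have Finv: "F r' (F r f) = f"
    if "diagram_aut Q r" "diagram_aut Q r'" "\<And>i. i \<in> nodes Q \<Longrightarrow> r' (r i) = i"
      "Poly_Mapping.keys f \<subseteq> carrier (BrM Q)" for r r' f
    using that(4) unfolding F_def
    by (induction f rule: frag_induction)
      (auto simp: frag_extend_diff class_map_inv[OF that(1,2,3)])
  have iso: "F s \<in> ring_iso (Br Q) (Br Q)"
  proof (rule ring_iso_memI)
    fix f g assume fg: "f \<in> carrier (Br Q)" "g \<in> carrier (Br Q)"
    show "F s (f \<oplus>\<^bsub>Br Q\<^esub> g) = F s f \<oplus>\<^bsub>Br Q\<^esub> F s g"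
      by (simp add: F_def Br_def monoid_algebra_def frag_extend_add)
    from fg have f: "Poly_Mapping.keys f \<subseteq> carrier (BrM Q)"
      and g: "Poly_Mapping.keys g \<subseteq> carrier (BrM Q)"
      by (auto simp: Br_def monoid_algebra_def)
    show "F s (f \<otimes>\<^bsub>Br Q\<^esub> g) = F s f \<otimes>\<^bsub>Br Q\<^esub> F s g"
      using f
    proof (induction f rule: frag_induction)
      case (one a)
      show ?case using g
        by (induction g rule: frag_induction)
          (use one in \<open>auto simp: F_def Br_def monoid_algebra_def frag_extend_diff hom\<close>)
    qed (auto simp: F_def Br_def monoid_algebra_def frag_extend_diff)
  next
    show "F s \<one>\<^bsub>Br Q\<^esub> = \<one>\<^bsub>Br Q\<^esub>"
      by (simp add: F_def Br_def monoid_algebra_def one_BrM class_map_class[OF s])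
    show "bij_betw (F s) (carrier (Br Q)) (carrier (Br Q))"
    proof (rule bij_betw_byWitness[where f' = "F t"])
      show "F s ` carrier (Br Q) \<subseteq> carrier (Br Q)" "F t ` carrier (Br Q) \<subseteq> carrier (Br Q)"
        unfolding Br_def monoid_algebra_def
        by (intro image_subsetI; simp add: Fcl[OF s] Fcl[OF t])+
    qed (simp_all add: Br_def monoid_algebra_def Finv[OF s t ts] Finv[OF t s st])
  qed (use Fcl[OF s] in \<open>auto simp: Br_def monoid_algebra_def\<close>)
  have "F s (br_gen Q g) = br_gen Q (map_brauer_gen s g)" if "g \<in> brauer_gens Q" for g
    using that by (simp add: F_def br_gen_def class_map_class[OF s])
  then have "extends_diagram_aut Q s (F s)"
    using iso by (auto simp: extends_diagram_aut_def brauer_gens_def)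
  then show ?thesis by (rule exI[of _ "F s"])
qed

lemma adjacent_A:
  assumes "i \<in> {1..m}" "j \<in> {1..m}"
  shows "adjacent (diagram_A m) i j \<longleftrightarrow> j = i + 1 \<or> i = j + 1"
  using assms by (auto simp: adjacent_def diagram_A_def doubleton_eq_iff)

lemma adjacent_D:
  assumes "i \<in> {1..m}" "j \<in> {1..m}"
  shows "adjacent (diagram_D m) i j \<longleftrightarrow>
    (i = 1 \<and> j = 3) \<or> (i = 3 \<and> j = 1) \<or> (i = 2 \<and> j = 3) \<or> (i = 3 \<and> j = 2) \<or>
    (3 \<le> i \<and> j = i + 1) \<or> (3 \<le> j \<and> i = j + 1)"
  using assms by (auto simp: adjacent_def diagram_D_def doubleton_eq_iff)

lemma diagram_aut_A:
  assumes "\<And>i. i \<in> {1..2 * n - 1} \<Longrightarrow> s i = 2 * n - i"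
  shows "diagram_aut (diagram_A (2 * n - 1)) s"
proof -
  let ?V = "{1..2 * n - 1}"
  have V: "nodes (diagram_A (2 * n - 1)) = ?V" by (simp add: diagram_A_def)
  have s: "s i \<in> ?V" "s (s i) = i" if "i \<in> ?V" for i
  proof -
    have *: "2 * n - i \<in> ?V" using that unfolding atLeastAtMost_iff by arith
    then show "s i \<in> ?V" using assms[OF that] by simp
    show "s (s i) = i" unfolding assms[OF that] assms[OF *] using that unfolding atLeastAtMost_iff by arith
  qed
  have "bij_betw s ?V ?V"
    by (rule bij_betw_byWitness[where f' = s]) (use s in blast)+
  moreover have "adjacent (diagram_A (2 * n - 1)) (s i) (s j) \<longleftrightarrow> adjacent (diagram_A (2 * n - 1)) i j"
    if ij: "i \<in> ?V" "j \<in> ?V" for i j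
  proof -
    have "s j = s i + 1 \<or> s i = s j + 1 \<longleftrightarrow> j = i + 1 \<or> i = j + 1"
      using ij unfolding assms[OF ij(1)] assms[OF ij(2)] atLeastAtMost_iff by arith
    then show ?thesis
      unfolding adjacent_A[OF ij] adjacent_A[OF s(1)[OF ij(1)] s(1)[OF ij(2)]] .
  qed
  ultimately show ?thesis unfolding diagram_aut_def V by blast
qed

lemma diagram_aut_D:
  assumes n: "n \<ge> 2" and s12: "s 1 = 2" "s 2 = 1"
    and s3: "\<And>i. i \<in> {1..n + 1} - {1, 2} \<Longrightarrow> s i = i"
  shows "diagram_aut (diagram_D (n + 1)) s"
proof -
  let ?V = "{1..n + 1}"
  have V: "nodes (diagram_D (n + 1)) = ?V" by (simp add: diagram_D_def)
  have e: "s i = (if i = 1 then 2 else if i = 2 then 1 else i)" if "i \<in> ?V" for i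
    using s12 s3[of i] that by simp
  have s: "s i \<in> ?V" "s (s i) = i" if "i \<in> ?V" for i
  proof -
    show *: "s i \<in> ?V" using that n unfolding e[OF that] by simp
    show "s (s i) = i" unfolding e[OF *] unfolding e[OF that] by simp
  qed
  have "bij_betw s ?V ?V"
    by (rule bij_betw_byWitness[where f' = s]) (use s in blast)+
  moreover have "adjacent (diagram_D (n + 1)) (s i) (s j) \<longleftrightarrow> adjacent (diagram_D (n + 1)) i j"
    if ij: "i \<in> ?V" "j \<in> ?V" for i j
    unfolding adjacent_D[OF ij] adjacent_D[OF s(1)[OF ij(1)] s(1)[OF ij(2)]]
    unfolding e[OF ij(1)] e[OF ij(2)] using ij by simp
  ultimately show ?thesis unfolding diagram_aut_def V by blast
qed

lemma diagram_aut_E6: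
  assumes "s 1 = 6" "s 6 = 1" "s 3 = 5" "s 5 = 3" "s 2 = 2" "s 4 = 4"
  shows "diagram_aut diagram_E6 s"
proof -
  have V: "nodes diagram_E6 = {1, 2, 3, 4, 5, 6}" by (auto simp: diagram_E6_def)
  have "bij_betw s {1, 2, 3, 4, 5, 6} {1, 2, 3, 4, 5, 6}"
    by (rule bij_betw_byWitness[where f' = s]) (simp_all add: assms[unfolded One_nat_def])
  then show ?thesis
    unfolding diagram_aut_def V
    by (simp add: assms[unfolded One_nat_def] adjacent_def diagram_E6_def doubleton_eq_iff)
qed

lemma diagram_aut_D4:
  assumes "s 3 = 3" "s 1 = 2 \<and> s 2 = 4 \<and> s 4 = 1 \<or> s 1 = 4 \<and> s 4 = 2 \<and> s 2 = 1"
  shows "diagram_aut (diagram_D 4) s"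
proof -
  let ?V = "{1, 2, 3, 4} :: nat set"
  have V: "nodes (diagram_D 4) = ?V" by (auto simp: diagram_D_def)
  have im: "s ` ?V = ?V" and inj: "inj_on s ?V"
    using assms by (elim disjE conjE; auto)+
  have adj: "adjacent (diagram_D 4) i j \<longleftrightarrow> i \<noteq> j \<and> (i = 3 \<or> j = 3)"
    if "i \<in> ?V" "j \<in> ?V" for i j
    using that by (elim insertE emptyE; simp add: adjacent_D)
  have "adjacent (diagram_D 4) (s i) (s j) \<longleftrightarrow> adjacent (diagram_D 4) i j"
    if ij: "i \<in> ?V" "j \<in> ?V" for i j
  proof -
    have mem: "s i \<in> ?V" "s j \<in> ?V" "3 \<in> ?V"
      using imageI[OF ij(1), of s] imageI[OF ij(2), of s] unfolding im by simp_all
    have "s i = s j \<longleftrightarrow> i = j" "s i = s 3 \<longleftrightarrow> i = 3" "s j = s 3 \<longleftrightarrow> j = 3"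
      by (rule inj_on_eq_iff[OF inj], fact ij mem, fact ij mem)+
    then show ?thesis
      unfolding adj[OF ij] adj[OF mem(1,2)] assms(1) by simp
  qed
  then show ?thesis
    unfolding diagram_aut_def V bij_betw_def using im inj by blast
qed

lemma diagram_aut_classical:
  assumes "classical_diagram_aut Q s"
  shows "diagram_aut Q s"
  using assms unfolding classical_diagram_aut_def
proof (elim disjE exE conjE)
  fix n :: nat
  assume "Q = diagram_A (2 * n - 1)" "\<forall>i\<in>nodes Q. s i = 2 * n - i"
  then show ?thesis using diagram_aut_A[of n s] by (simp add: diagram_A_def)
next
  fix n :: nat
  assume "2 \<le> n" "Q = diagram_D (n + 1)" "s 1 = 2" "s 2 = 1" "\<forall>i\<in>nodes Q - {1, 2}. s i = i"
  then show ?thesis using diagram_aut_D[of n s] by (simp add: diagram_D_def)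
next
  assume "Q = diagram_E6" "s 1 = 6" "s 6 = 1" "s 3 = 5" "s 5 = 3" "s 2 = 2" "s 4 = 4"
  then show ?thesis using diagram_aut_E6[of s] by simp
next
  assume "Q = diagram_D 4" "s 3 = 3" "s 1 = 2" "s 2 = 4" "s 4 = 1"
  then show ?thesis using diagram_aut_D4[of s] by simp
next
  assume "Q = diagram_D 4" "s 3 = 3" "s 1 = 4" "s 4 = 2" "s 2 = 1"
  then show ?thesis using diagram_aut_D4[of s] by simp
qed

end

(* A diagram automorphism permutes the letters of a word without changing how many of them
   are of type R; so do both it and its inverse on words representing a monomial and its image,
   and the minima agree. The only generator whose image is not prescribed is the inverse of
   delta, and uniqueness of inverses settles that one. *)

theory Submission
  imports Defs
begin

lemma is_R_map_brauer_gen [simp]: "is_R (map_brauer_gen s g) = is_R g"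
  by (cases g) simp_all

text \<open>Membership in the carrier supplies at least one representing word, so the
  \<open>LEAST\<close> in \<open>ht\<close> ranges over a nonempty set and is attained.\<close>

lemma ht_witness:
  assumes "a \<in> carrier (BrM Q)"
  obtains w where "w \<in> lists (brauer_gens Q)" "brauer_class Q w = a"
    "length (filter is_R w) = ht Q a"
proof -
  let ?P = "\<lambda>k. \<exists>w\<in>lists (brauer_gens Q). brauer_class Q w = a \<and> k = length (filter is_R w)"
  have "\<exists>k. ?P k"
    using assms by (auto simp: carrier_BrM simp del: in_lists_conv_set)
  from LeastI_ex[OF this] show thesis
    using that unfolding ht_def by metis
qed

lemma ht_le:
  assumes "w \<in> lists (brauer_gens Q)"
  shows "ht Q (brauer_class Q w) \<le> length (filter is_R w)"
  unfolding ht_def using assms by (intro Least_le bexI[of _ w]) simp_all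

lemma class_map_closed:
  assumes "diagram_aut Q s" "a \<in> carrier (BrM Q)"
  shows "class_map Q s a \<in> carrier (BrM Q)"
proof -
  from assms(2) obtain w where w: "w \<in> lists (brauer_gens Q)" "a = brauer_class Q w"
    unfolding carrier_BrM by (rule imageE)
  show ?thesis
    unfolding w(2) class_map_class[OF assms(1) w(1)] carrier_BrM
    by (rule imageI[OF map_word_lists[OF assms(1) w(1)]])
qed

text \<open>Relabelling a word that attains the height preserves its number of R letters. The new
  word is not known to be optimal for the image, so this gives only an upper bound.\<close>

lemma ht_class_map_le:
  assumes "diagram_aut Q s" "a \<in> carrier (BrM Q)"
  shows "ht Q (class_map Q s a) \<le> ht Q a"
proof -
  obtain w where w: "w \<in> lists (brauer_gens Q)" "brauer_class Q w = a"
    "length (filter is_R w) = ht Q a"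
    using ht_witness[OF assms(2)] .
  have "ht Q (class_map Q s a) \<le> length (filter is_R (map (map_brauer_gen s) w))"
    using ht_le[OF map_word_lists[OF assms(1) w(1)]] class_map_class[OF assms(1) w(1)] w(2)
    by simp
  then show ?thesis
    using w(3) by (simp add: filter_map o_def)
qed

lemma ht_class_map:
  assumes s: "diagram_aut Q s" and a: "a \<in> carrier (BrM Q)"
  shows "ht Q (class_map Q s a) = ht Q a"
proof (rule antisym)
  show "ht Q (class_map Q s a) \<le> ht Q a"
    by (rule ht_class_map_le[OF assms])
  \<comment> \<open>The inverse automorphism carries the image monomial back to \<open>a\<close>;
    the same upper bound, applied to it, is the reverse inequality.\<close>
  define t where "t = inv_into (nodes Q) s"
  have t: "diagram_aut Q t"
    unfolding t_def by (rule diagram_aut_inv[OF s])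
  have "t (s i) = i" if "i \<in> nodes Q" for i
    using s that unfolding t_def diagram_aut_def by (auto simp: bij_betw_inv_into_left)
  then have "class_map Q t (class_map Q s a) = a"
    by (rule class_map_inv[OF s t _ a])
  then show "ht Q a \<le> ht Q (class_map Q s a)"
    using ht_class_map_le[OF t class_map_closed[OF assms]] by simp
qed

text \<open>On basis vectors the bilinear product reduces to concatenation of words, which lets a
  ring homomorphism be evaluated letter by letter.\<close>

lemma mult_Br_frag_of:
  assumes "u \<in> lists (brauer_gens Q)" "v \<in> lists (brauer_gens Q)"
  shows "frag_of (brauer_class Q u) \<otimes>\<^bsub>Br Q\<^esub> frag_of (brauer_class Q v)
    = frag_of (brauer_class Q (u @ v))"
  by (simp add: Br_def monoid_algebra_def mult_BrM[OF assms])

lemma one_Br: "\<one>\<^bsub>Br Q\<^esub> = frag_of (brauer_class Q [])"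
  by (simp add: Br_def monoid_algebra_def one_BrM)

lemma frag_of_class_closed:
  assumes "w \<in> lists (brauer_gens Q)"
  shows "frag_of (brauer_class Q w) \<in> carrier (Br Q)"
  using imageI[OF assms, of "brauer_class Q"] by (simp add: Br_def monoid_algebra_def carrier_BrM)

lemma Delta_DeltaInv_Br:
  "br_gen Q Delta \<otimes>\<^bsub>Br Q\<^esub> br_gen Q DeltaInv = \<one>\<^bsub>Br Q\<^esub>"
  "br_gen Q DeltaInv \<otimes>\<^bsub>Br Q\<^esub> br_gen Q Delta = \<one>\<^bsub>Br Q\<^esub>"
proof -
  have gens: "[Delta] \<in> lists (brauer_gens Q)" "[DeltaInv] \<in> lists (brauer_gens Q)"
    by (simp_all add: brauer_gens_def)
  have rel: "(u, v) \<in> brauer_cong Q" if "brauer_rel Q u v" for u v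
    using cong_rel[OF that, of "[]" "[]"] by simp
  have *: "brauer_class Q [Delta, DeltaInv] = brauer_class Q []"
    by (rule brauer_class_eqI[OF rel[OF delta_inv]])
  \<comment> \<open>Centrality of \<open>Delta\<close>, taken at the generator
    \<open>DeltaInv\<close>, turns the one-sided relation into a two-sided inverse.\<close>
  have "brauer_class Q [Delta, DeltaInv] = brauer_class Q [DeltaInv, Delta]"
    by (rule brauer_class_eqI[OF rel[OF delta_central]]) (simp add: brauer_gens_def)
  with * show "br_gen Q Delta \<otimes>\<^bsub>Br Q\<^esub> br_gen Q DeltaInv = \<one>\<^bsub>Br Q\<^esub>"
    "br_gen Q DeltaInv \<otimes>\<^bsub>Br Q\<^esub> br_gen Q Delta = \<one>\<^bsub>Br Q\<^esub>"
    unfolding br_gen_def mult_Br_frag_of[OF gens] mult_Br_frag_of[OF gens(2,1)] one_Br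
    by simp_all
qed

lemma extends_diagram_aut_gen:
  assumes "extends_diagram_aut Q s \<sigma>" "g \<in> brauer_gens Q"
  shows "\<sigma> (br_gen Q g) = br_gen Q (map_brauer_gen s g)"
proof (cases g)
  case DeltaInv
  interpret ring "Br Q" by (rule ring_Br)
  have hom: "\<sigma> \<in> ring_hom (Br Q) (Br Q)" and d: "\<sigma> (br_gen Q Delta) = br_gen Q Delta"
    using assms(1) by (simp_all add: extends_diagram_aut_def ring_iso_def)
  have gens: "br_gen Q Delta \<in> carrier (Br Q)" "br_gen Q DeltaInv \<in> carrier (Br Q)"
    unfolding br_gen_def by (rule frag_of_class_closed; simp add: brauer_gens_def)+
  \<comment> \<open>Applying \<sigma> to the identity for \<open>DeltaInv\<close> times
    \<open>Delta\<close> yields a left inverse of \<open>Delta\<close>, since \<sigma> fixes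
    \<open>Delta\<close>; it must agree with the right inverse \<open>DeltaInv\<close>.\<close>
  have "\<sigma> (br_gen Q DeltaInv) \<otimes>\<^bsub>Br Q\<^esub> br_gen Q Delta = \<one>\<^bsub>Br Q\<^esub>"
    using ring_hom_mult[OF hom gens(2,1)] ring_hom_one[OF hom] d
    by (simp add: Delta_DeltaInv_Br)
  then have "\<sigma> (br_gen Q DeltaInv) = br_gen Q DeltaInv"
    using inv_unique Delta_DeltaInv_Br(1) gens ring_hom_closed[OF hom gens(2)] by metis
  then show ?thesis
    using DeltaInv by simp
qed (use assms in \<open>auto simp: extends_diagram_aut_def brauer_gens_def\<close>)

text \<open>A unital multiplicative map is determined on words by its values on letters, by
  induction on the word.\<close>

lemma extends_diagram_aut_word:
  assumes s: "diagram_aut Q s" and \<sigma>: "extends_diagram_aut Q s \<sigma>"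
    and "w \<in> lists (brauer_gens Q)"
  shows "\<sigma> (frag_of (brauer_class Q w)) = frag_of (brauer_class Q (map (map_brauer_gen s) w))"
  using assms(3)
proof (induction w)
  have hom: "\<sigma> \<in> ring_hom (Br Q) (Br Q)"
    using \<sigma> by (simp add: extends_diagram_aut_def ring_iso_def)
  {
    case Nil
    show ?case
      using ring_hom_one[OF hom] by (simp add: one_Br)
  next
    case (Cons g w)
    have g: "[g] \<in> lists (brauer_gens Q)" and g': "[map_brauer_gen s g] \<in> lists (brauer_gens Q)"
      using Cons.hyps map_gen[OF s] by simp_all
    \<comment> \<open>Writing the word as \<open>[g] @ w\<close> exposes a product of two basis
      vectors: the first factor falls under the generator case, the second under the induction
      hypothesis.\<close>
    have "\<sigma> (frag_of (brauer_class Q ([g] @ w)))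
        = frag_of (brauer_class Q ([map_brauer_gen s g] @ map (map_brauer_gen s) w))"
      unfolding mult_Br_frag_of[OF g Cons.hyps(2), symmetric]
        mult_Br_frag_of[OF g' map_word_lists[OF s Cons.hyps(2)], symmetric]
        ring_hom_mult[OF hom frag_of_class_closed[OF g] frag_of_class_closed[OF Cons.hyps(2)]]
        Cons.IH extends_diagram_aut_gen[OF \<sigma> Cons.hyps(1), unfolded br_gen_def] ..
    then show ?case by simp
  }
qed

text \<open>This passes from the algebra to the monoid: \<sigma> sends monomials to monomials, so
  the height of an image makes sense.\<close>

lemma extends_diagram_aut_frag_of:
  assumes "diagram_aut Q s" "extends_diagram_aut Q s \<sigma>" "a \<in> carrier (BrM Q)"
  shows "\<sigma> (frag_of a) = frag_of (class_map Q s a)"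
proof -
  from assms(3) obtain w where w: "w \<in> lists (brauer_gens Q)" "a = brauer_class Q w"
    unfolding carrier_BrM by (rule imageE)
  show ?thesis
    unfolding w(2) class_map_class[OF assms(1) w(1)]
    by (rule extends_diagram_aut_word[OF assms(1,2) w(1)])
qed

theorem corollary3p4:
  fixes Q :: "nat graph" and s :: "nat \<Rightarrow> nat"
    and \<sigma> :: "(nat brauer_gen list set \<Rightarrow>\<^sub>0 int) \<Rightarrow> (nat brauer_gen list set \<Rightarrow>\<^sub>0 int)"
  assumes "classical_diagram_aut Q s"
    and "extends_diagram_aut Q s \<sigma>"
  shows "\<forall>a\<in>carrier (BrM Q). \<exists>b\<in>carrier (BrM Q).
           \<sigma> (frag_of a) = frag_of b \<and> ht Q b = ht Q a"
proof
  fix a assume a: "a \<in> carrier (BrM Q)"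
  have s: "diagram_aut Q s"
    by (rule diagram_aut_classical[OF assms(1)])
  \<comment> \<open>The witness is \<open>class_map Q s a\<close>. Since \<open>frag_of\<close> is
    injective, it is the only monomial that \<sigma> can assign to \<open>a\<close>.\<close>
  show "\<exists>b\<in>carrier (BrM Q). \<sigma> (frag_of a) = frag_of b \<and> ht Q b = ht Q a"
    using extends_diagram_aut_frag_of[OF s assms(2) a] ht_class_map[OF s a]
      class_map_closed[OF s a] by blast
qed

end
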